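(* Let $n>5$, and let $\phi\colon wB_n\to G$ be a group homomorphism to a finite group $G$. One of the following must be true: \begin{enumerate} \item $\phi$ is abelian. \item $\phi$ restricted to $PwB_n$ is cyclic. \item $|\phi(wB_n)|\ge 2^{n-2}(n-1)!$. \item For all $i$ and $j$, $\phi$ maps each $A_i$ to a single element with $\phi(A_i)^2\neq\phi(A_j)^2$, and \[ |\phi(wB_n)|\ \geq\ \left(\left\lfloor\frac n2\right\rfloor+1\right)\left(3^{\lfloor \frac n2\rfloor-1}\right)\left\lceil\frac n2\right\rceil!\,. \] \end{enumerate}
   Context: A homomorphism is called cyclic (resp. abelian) if its image is a cyclic (resp. abelian) group. When $\phi$ maps $A_i$ to a single element, $\phi(A_i)$ also denotes that element. The virtual braid group $vB_n$ has generators $\sigma_1,\dots,\sigma_{n-1},\tau_1,\dots,\tau_{n-1}$ and relations: (1) $\sigma_i\sigma_j=\sigma_j\sigma_i$ for $|i-j|>1$; (2) $\sigma_i\sigma_{i+1}\sigma_i=\sigma_{i+1}\sigma_i\sigma_{i+1}$ for $1\le i\le n-2$; (3) $\tau_i^2=1$ for $1\le i\le n-1$; (4) $\tau_i\tau_j=\tau_j\tau_i$ for $|i-j|>1$; (5) $\tau_i\tau_{i+1}\tau_i=\tau_{i+1}\tau_i\tau_{i+1}$ for $1\le i\le n-2$; (6) $\sigma_i\tau_j=\tau_j\sigma_i$ for $|i-j|>1$; (7) $\tau_{i+1}\sigma_i\tau_{i+1}=\tau_i\sigma_{i+1}\tau_i$ for $1\le i\le n-2$. The welded braid group $wB_n$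 is the quotient of $vB_n$ by the additional relations $\tau_i\sigma_{i+1}\sigma_i=\sigma_{i+1}\sigma_i\tau_{i+1}$ for $1\le i\le n-2$. For distinct $i,j\in\{1,\dots,n\}$, define $\sigma_{i,j}=\tau_i\tau_{i+1}\cdots\tau_{j-2}\,\tau_{j-1}\sigma_{j-1}\,\tau_{j-2}\cdots\tau_{i+1}\tau_i$ if $i<j$, and $\sigma_{i,j}=\tau_{i-1}\tau_{i-2}\cdots\tau_{j+1}\,\sigma_j\tau_j\,\tau_{j+1}\cdots\tau_{i-2}\tau_{i-1}$ if $j<i$ (so $\sigma_{i,i+1}=\tau_i\sigma_i$ and $\sigma_{i+1,i}=\sigma_i\tau_i$). For each $i\in\{1,\dots,n\}$, $A_i=\{\sigma_{i,j}: 1\le j\le n,\ j\ne i\}\subseteq wB_n$. The pure welded braid group $PwB_n$ is the subgroup of $wB_n$ generated by all $\sigma_{i,j}$ with $i\neq j$. *)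

theory Defs
  imports "HOL-Algebra.Algebra"
begin

section \<open>Groups given by generators and relations\<close>

text \<open>
  The letter \<open>(x, False)\<close> stands for the generator \<open>x\<close>, the letter \<open>(x, True)\<close> for its formal
  inverse. A relation \<open>l = r\<close> is a pair of words \<open>(l, r)\<close>.
\<close>

type_synonym 'x group_word = "('x \<times> bool) list"

definition group_words :: "'x set \<Rightarrow> 'x group_word set" where
  "group_words S = lists (S \<times> UNIV)"

inductive_set pres_rel ::
    "'x set \<Rightarrow> ('x group_word \<times> 'x group_word) set \<Rightarrow> ('x group_word \<times> 'x group_word) set"
  for S :: "'x set" and R :: "('x group_word \<times> 'x group_word) set"
where
  refl: "w \<in> group_words S \<Longrightarrow> (w, w) \<in> pres_rel S R"
| sym: "(v, w) \<in> pres_rel S R \<Longrightarrow> (w, v) \<in> pres_rel S R"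
| trans: "(u, v) \<in> pres_rel S R \<Longrightarrow> (v, w) \<in> pres_rel S R \<Longrightarrow> (u, w) \<in> pres_rel S R"
| cancel: "u \<in> group_words S \<Longrightarrow> v \<in> group_words S \<Longrightarrow> x \<in> S \<Longrightarrow>
    (u @ [(x, b), (x, \<not> b)] @ v, u @ v) \<in> pres_rel S R"
| relation: "(l, r) \<in> R \<Longrightarrow> l \<in> group_words S \<Longrightarrow> r \<in> group_words S \<Longrightarrow>
    u \<in> group_words S \<Longrightarrow> v \<in> group_words S \<Longrightarrow> (u @ l @ v, u @ r @ v) \<in> pres_rel S R"

definition presented_group ::
    "'x set \<Rightarrow> ('x group_word \<times> 'x group_word) set \<Rightarrow> 'x group_word set monoid" where
  "presented_group S R =
    \<lparr>carrier = group_words S // pres_rel S R,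
     monoid.mult = (\<lambda>U V. \<Union>u\<in>U. \<Union>v\<in>V. pres_rel S R `` {u @ v}),
     one = pres_rel S R `` {[]}\<rparr>"

lemma group_words_append [simp]:
  "u @ v \<in> group_words S \<longleftrightarrow> u \<in> group_words S \<and> v \<in> group_words S"
  by (auto simp: group_words_def)

lemma group_words_Nil [simp]: "[] \<in> group_words S"
  by (simp add: group_words_def)

lemma group_words_Cons [simp]:
  "a # v \<in> group_words S \<longleftrightarrow> fst a \<in> S \<and> v \<in> group_words S"
  by (cases a) (auto simp: group_words_def)

lemma pres_rel_words:
  "(u, v) \<in> pres_rel S R \<Longrightarrow> u \<in> group_words S \<and> v \<in> group_words S"
  by (induction rule: pres_rel.induct) auto

lemma equiv_pres_rel: "equiv (group_words S) (pres_rel S R)"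
proof (rule equivI)
  show "pres_rel S R \<subseteq> group_words S \<times> group_words S"
    using pres_rel_words by fastforce
  show "refl_on (group_words S) (pres_rel S R)"
    using pres_rel_words by (fastforce intro: refl_onI pres_rel.refl)
  show "sym (pres_rel S R)" by (auto intro: symI pres_rel.sym)
  show "trans (pres_rel S R)" by (auto intro: transI pres_rel.trans)
qed

lemma pres_rel_context:
  assumes "(u, v) \<in> pres_rel S R" "a \<in> group_words S" "b \<in> group_words S"
  shows "(a @ u @ b, a @ v @ b) \<in> pres_rel S R"
  using assms
proof (induction rule: pres_rel.induct)
  case (cancel u v x c)
  then show ?case using pres_rel.cancel[where u = "a @ u" and v = "v @ b" and x = x and b = c and R = R] by simp
next
  case (relation l r u v)
  then show ?case using pres_rel.relation[where u = "a @ u" and v = "v @ b" and l = l and r = r and R = R] by simp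
qed (auto intro: pres_rel.intros)

lemma pres_rel_append:
  assumes "(u, u') \<in> pres_rel S R" "(v, v') \<in> pres_rel S R"
  shows "(u @ v, u' @ v') \<in> pres_rel S R"
proof -
  have "(u @ v, u' @ v) \<in> pres_rel S R"
    using pres_rel_context[OF assms(1), of "[]" v] pres_rel_words[OF assms(2)] by simp
  moreover have "(u' @ v, u' @ v') \<in> pres_rel S R"
    using pres_rel_context[OF assms(2), of u' "[]"] pres_rel_words[OF assms(1)] by simp
  ultimately show ?thesis by (rule pres_rel.trans)
qed

lemma presented_group_carrierE:
  assumes "U \<in> carrier (presented_group S R)"
  obtains w where "w \<in> group_words S" "U = pres_rel S R `` {w}"
  using assms by (auto simp: presented_group_def elim: quotientE)

lemma presented_group_class:
  "w \<in> group_words S \<Longrightarrow> pres_rel S R `` {w} \<in> carrier (presented_group S R)"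
  by (auto simp: presented_group_def intro: quotientI)

lemma presented_group_one: "\<one>\<^bsub>presented_group S R\<^esub> = pres_rel S R `` {[]}"
  by (simp add: presented_group_def)

lemma presented_group_mult:
  assumes "u \<in> group_words S" "v \<in> group_words S"
  shows "pres_rel S R `` {u} \<otimes>\<^bsub>presented_group S R\<^esub> pres_rel S R `` {v} = pres_rel S R `` {u @ v}"
proof -
  have "pres_rel S R `` {x @ y} = pres_rel S R `` {u @ v}"
    if "x \<in> pres_rel S R `` {u}" "y \<in> pres_rel S R `` {v}" for x y
    using that equiv_class_eq[OF equiv_pres_rel pres_rel_append, of u x S R v y] by simp
  moreover have "u \<in> pres_rel S R `` {u}" "v \<in> pres_rel S R `` {v}"
    using assms by (auto intro: pres_rel.refl)
  ultimately show ?thesis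
    unfolding presented_group_def monoid.simps by blast
qed

definition inv_word :: "'x group_word \<Rightarrow> 'x group_word" where
  "inv_word w = rev (map (\<lambda>(x, b). (x, \<not> b)) w)"

lemma inv_word_words: "w \<in> group_words S \<Longrightarrow> inv_word w \<in> group_words S"
  by (auto simp: inv_word_def group_words_def)

lemma inv_word_cancel:
  "w \<in> group_words S \<Longrightarrow> (inv_word w @ w, []) \<in> pres_rel S R"
proof (induction w)
  case Nil
  then show ?case by (auto simp: inv_word_def intro: pres_rel.refl)
next
  case (Cons a w)
  obtain x b where a: "a = (x, b)" by (cases a)
  have "(inv_word w @ [(x, \<not> b), (x, \<not> \<not> b)] @ w, inv_word w @ w) \<in> pres_rel S R"
    by (rule pres_rel.cancel) (use Cons a in \<open>auto intro: inv_word_words\<close>)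
  then have "(inv_word (a # w) @ (a # w), inv_word w @ w) \<in> pres_rel S R"
    by (simp add: a inv_word_def)
  with Cons show ?case by (auto intro: pres_rel.trans)
qed

theorem group_presented_group: "group (presented_group S R)"
proof (rule groupI)
  fix U assume "U \<in> carrier (presented_group S R)"
  then obtain w where w: "w \<in> group_words S" "U = pres_rel S R `` {w}"
    by (rule presented_group_carrierE)
  have "pres_rel S R `` {inv_word w} \<otimes>\<^bsub>presented_group S R\<^esub> U = \<one>\<^bsub>presented_group S R\<^esub>"
    using w inv_word_words[OF w(1)] inv_word_cancel[OF w(1), of R]
    by (simp add: presented_group_mult presented_group_one equiv_class_eq[OF equiv_pres_rel])
  then show "\<exists>V\<in>carrier (presented_group S R). V \<otimes>\<^bsub>presented_group S R\<^esub> U = \<one>\<^bsub>presented_group S R\<^esub>"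
    using presented_group_class[OF inv_word_words[OF w(1)]] by blast
qed (auto elim!: presented_group_carrierE
      simp: presented_group_mult presented_group_one presented_group_class)


section \<open>The welded braid group\<close>

datatype braid_gen = Sigma_gen nat | Tau_gen nat

definition braid_gens :: "nat \<Rightarrow> braid_gen set" where
  "braid_gens n = Sigma_gen ` {1..<n} \<union> Tau_gen ` {1..<n}"

abbreviation sg :: "nat \<Rightarrow> braid_gen \<times> bool" where "sg i \<equiv> (Sigma_gen i, False)"
abbreviation tu :: "nat \<Rightarrow> braid_gen \<times> bool" where "tu i \<equiv> (Tau_gen i, False)"

definition vB_rels :: "nat \<Rightarrow> (braid_gen group_word \<times> braid_gen group_word) set" where
  "vB_rels n =
     {([sg i, sg j], [sg j, sg i]) | i j. i \<in> {1..n-1} \<and> j \<in> {1..n-1} \<and> \<bar>int i - int j\<bar> > 1}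
   \<union> {([sg i, sg (i+1), sg i], [sg (i+1), sg i, sg (i+1)]) | i. i \<in> {1..n-2}}
   \<union> {([tu i, tu i], []) | i. i \<in> {1..n-1}}
   \<union> {([tu i, tu j], [tu j, tu i]) | i j. i \<in> {1..n-1} \<and> j \<in> {1..n-1} \<and> \<bar>int i - int j\<bar> > 1}
   \<union> {([tu i, tu (i+1), tu i], [tu (i+1), tu i, tu (i+1)]) | i. i \<in> {1..n-2}}
   \<union> {([sg i, tu j], [tu j, sg i]) | i j. i \<in> {1..n-1} \<and> j \<in> {1..n-1} \<and> \<bar>int i - int j\<bar> > 1}
   \<union> {([tu (i+1), sg i, tu (i+1)], [tu i, sg (i+1), tu i]) | i. i \<in> {1..n-2}}"

definition wB_rels :: "nat \<Rightarrow> (braid_gen group_word \<times> braid_gen group_word) set" where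
  "wB_rels n = vB_rels n
   \<union> {([tu i, sg (i+1), sg i], [sg (i+1), sg i, tu (i+1)]) | i. i \<in> {1..n-2}}"

definition wB :: "nat \<Rightarrow> braid_gen group_word set monoid" where
  "wB n = presented_group (braid_gens n) (wB_rels n)"

text \<open>
  The word below is meaningful for \<open>i \<noteq> j\<close> only. The list \<open>[i..<j-1]\<close> is \<open>i, \<dots>, j-2\<close> and the
  list \<open>rev [j+1..<i]\<close> is \<open>i-1, \<dots>, j+1\<close>.
\<close>

definition sigma_word :: "nat \<Rightarrow> nat \<Rightarrow> braid_gen group_word" where
  "sigma_word i j =
    (if i < j
     then map tu [i..<j-1] @ [tu (j-1), sg (j-1)] @ map tu (rev [i..<j-1])
     else map tu (rev [j+1..<i]) @ [sg j, tu j] @ map tu [j+1..<i])"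

definition wB_sigma :: "nat \<Rightarrow> nat \<Rightarrow> nat \<Rightarrow> braid_gen group_word set" where
  "wB_sigma n i j = pres_rel (braid_gens n) (wB_rels n) `` {sigma_word i j}"

definition A_set :: "nat \<Rightarrow> nat \<Rightarrow> braid_gen group_word set set" where
  "A_set n i = {wB_sigma n i j | j. j \<in> {1..n} \<and> j \<noteq> i}"

definition PwB :: "nat \<Rightarrow> braid_gen group_word set monoid" where
  "PwB n = subgroup_generated (wB n) {wB_sigma n i j | i j. i \<in> {1..n} \<and> j \<in> {1..n} \<and> i \<noteq> j}"

lemma group_wB: "group (wB n)"
  unfolding wB_def by (rule group_presented_group)

lemma wB_sigma_in_carrier:
  assumes "i \<in> {1..n}" "j \<in> {1..n}" "i \<noteq> j"
  shows "wB_sigma n i j \<in> carrier (wB n)"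
proof -
  have gens: "Sigma_gen k \<in> braid_gens n \<longleftrightarrow> k \<in> {1..<n}" "Tau_gen k \<in> braid_gens n \<longleftrightarrow> k \<in> {1..<n}" for k
    by (auto simp: braid_gens_def)
  have taus: "map tu xs \<in> group_words (braid_gens n) \<longleftrightarrow> set xs \<subseteq> {1..<n}" for xs
    by (induction xs) (auto simp: gens)
  have "sigma_word i j \<in> group_words (braid_gens n)"
    using assms by (auto simp: sigma_word_def gens taus)
  then show ?thesis
    unfolding wB_sigma_def wB_def by (rule presented_group_class)
qed


section \<open>Cyclic and abelian homomorphisms\<close>

definition hom_image ::
    "('a, 'c) monoid_scheme \<Rightarrow> ('b, 'd) monoid_scheme \<Rightarrow> ('a \<Rightarrow> 'b) \<Rightarrow> ('b, 'd) monoid_scheme" where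
  "hom_image H G \<phi> = G\<lparr>carrier := \<phi> ` carrier H\<rparr>"

definition cyclic_hom ::
    "('a, 'c) monoid_scheme \<Rightarrow> ('b, 'd) monoid_scheme \<Rightarrow> ('a \<Rightarrow> 'b) \<Rightarrow> bool" where
  "cyclic_hom H G \<phi> \<longleftrightarrow> cyclic_group (hom_image H G \<phi>)"

definition abelian_hom ::
    "('a, 'c) monoid_scheme \<Rightarrow> ('b, 'd) monoid_scheme \<Rightarrow> ('a \<Rightarrow> 'b) \<Rightarrow> bool" where
  "abelian_hom H G \<phi> \<longleftrightarrow> comm_group (hom_image H G \<phi>)"

end

theory Submission
  imports Defs
begin

text \<open>
  Conjugation by the image of \<open>S\<^sub>n = \<langle>\<tau>\<^sub>1, \<dots>, \<tau>\<^sub>n\<^sub>-\<^sub>1\<rangle>\<close> permutes the indices of the \<open>\<sigma>\<^sub>i\<^sub>,\<^sub>j\<close>. If \<open>m\<close> distinct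
  commuting elements of a finite group are permuted in all possible ways by conjugation, then the
  group has at least \<open>2\<^sup>m\<^sup>-\<^sup>1 m!\<close> elements: the products over subsets omitting one fixed element are
  pairwise distinct, and they centralise the \<open>m\<close> elements, on which the conjugations realise all of
  \<open>S\<^sub>m\<close>; moreover, such a family is either injective or constant. Applied to the image of \<open>A\<^sub>n\<close>, this
  gives the bound unless \<open>A\<^sub>n\<close>, hence every \<open>A\<^sub>i\<close>, collapses to one element \<open>a\<^sub>i\<close>. The \<open>a\<^sub>i\<close> commute,
  since \<open>\<sigma>\<^sub>i\<^sub>,\<^sub>j\<close> and \<open>\<sigma>\<^sub>k\<^sub>,\<^sub>l\<close> do for distinct indices. So either the \<open>a\<^sub>i\<close> give an even larger bound, or
  all of them are equal and the image of the pure group is cyclic.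
\<close>

section \<open>Permutations of indices and the action of adjacent transpositions\<close>

lemma permutes_extending_list:
  assumes "distinct xs" "distinct ys" "length xs = length ys" "set xs \<subseteq> A" "set ys \<subseteq> A"
  obtains p where "p permutes A" "map p xs = ys"
proof -
  have "\<exists>p. p permutes A \<and> map p xs = ys"
    using assms(3,1,2,4,5)
  proof (induction xs ys rule: list_induct2)
    case Nil
    show ?case by (intro exI[of _ id] conjI permutes_id) simp
  next
    case (Cons x xs y ys)
    then obtain p where p: "p permutes A" "map p xs = ys" by auto
    \<comment> \<open>Following \<open>p\<close> by this swap moves \<open>p x\<close> to
      \<open>y\<close>; the images of the later entries avoid both points and so stay as they
      are.\<close>
    let ?q = "Transposition.transpose (p x) y \<circ> p"
    have px: "p x \<in> A" using p(1) Cons.prems by (simp add: permutes_in_image)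
    have "p z \<noteq> p x" "p z \<noteq> y" if "z \<in> set xs" for z
      using that p Cons.prems permutes_inj[OF p(1)] by (auto dest: injD)
    then have "map ?q (x # xs) = y # ys"
      using p(2) by (auto simp: Transposition.transpose_def)
    moreover have "?q permutes A"
      using p(1) px Cons.prems by (intro permutes_compose permutes_swap_id) auto
    ultimately show ?case by (intro exI[of _ ?q] conjI)
  qed
  then show ?thesis using that by blast
qed

text \<open>An induction principle along the generation of the symmetric group: longer
  transpositions arise from adjacent ones through \<open>(a b+1) = (b b+1)(a b)(b b+1)\<close>, and
  every permutation is composed of transpositions.\<close>

lemma adjacent_transpositions_generate:
  fixes p :: "nat \<Rightarrow> nat"
  assumes "p permutes {1..n}"
    and id: "P id"
    and comp: "\<And>p q. P p \<Longrightarrow> P q \<Longrightarrow> p permutes {1..n} \<Longrightarrow> q permutes {1..n} \<Longrightarrow> P (p \<circ> q)"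
    and adj: "\<And>k. k \<in> {1..<n} \<Longrightarrow> P (Transposition.transpose k (Suc k))"
  shows "P p"
proof -
  have step: "P (Transposition.transpose a (a + Suc d))" if "1 \<le> a" "a + Suc d \<le> n" for a d
    using that
  proof (induction d)
    case 0
    then show ?case using adj[of a] by simp
  next
    case (Suc d)
    let ?b = "a + Suc d"
    have eq: "Transposition.transpose a (Suc ?b)
        = Transposition.transpose ?b (Suc ?b) \<circ> (Transposition.transpose a ?b \<circ> Transposition.transpose ?b (Suc ?b))"
      by (auto simp: fun_eq_iff Transposition.transpose_def)
    have perm: "Transposition.transpose ?b (Suc ?b) permutes {1..n}"
      "Transposition.transpose a ?b permutes {1..n}"
      using Suc.prems by (auto intro!: permutes_swap_id)
    have "P (Transposition.transpose a (Suc ?b))"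
      unfolding eq using Suc perm adj[of ?b]
      by (intro comp permutes_compose) auto
    then show ?case by simp
  qed
  have tr: "P (Transposition.transpose a b)" if "a \<in> {1..n}" "b \<in> {1..n}" for a b
  proof (cases a b rule: linorder_cases)
    case less
    then show ?thesis using that step[of a "b - a - 1"] by simp
  next
    case greater
    then show ?thesis using that step[of b "a - b - 1"] by (simp add: transpose_commute)
  qed (simp add: id)
  show ?thesis
    using assms(1) finite_atLeastAtMost
  proof (induction rule: permutes_induct)
    case id
    show ?case by (rule assms(2))
  next
    case (swap a b p)
    then show ?case by (intro comp tr permutes_swap_id) auto
  qed
qed

text \<open>Here \<open>c k\<close> stands for conjugation by the image of
  \<open>\<tau>\<^sub>k\<close>, and \<open>e i j\<close> for the image of
  \<open>\<sigma>\<^sub>i\<^sub>,\<^sub>j\<close> with \<open>i < j\<close>. Induction on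
  \<open>j - i\<close> peels off the outermost conjugation. The excluded swap reverses an adjacent
  pair and would leave the increasing range, outside which nothing is assumed about
  \<open>e\<close>.\<close>

lemma adjacent_action_increasing:
  fixes c :: "nat \<Rightarrow> 'a \<Rightarrow> 'a" and e :: "nat \<Rightarrow> nat \<Rightarrow> 'a"
  assumes invol: "\<And>k x. k \<in> {1..<n} \<Longrightarrow> x \<in> C \<Longrightarrow> c k (c k x) = x"
    and comm: "\<And>k l x. k \<in> {1..<n} \<Longrightarrow> l \<in> {1..<n} \<Longrightarrow> \<bar>int k - int l\<bar> > 1 \<Longrightarrow> x \<in> C \<Longrightarrow>
        c k (c l x) = c l (c k x)"
    and braid: "\<And>k x. 1 \<le> k \<Longrightarrow> Suc k < n \<Longrightarrow> x \<in> C \<Longrightarrow>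
        c (Suc k) (c k (c (Suc k) x)) = c k (c (Suc k) (c k x))"
    and mem: "\<And>i j. 1 \<le> i \<Longrightarrow> i < j \<Longrightarrow> j \<le> n \<Longrightarrow> e i j \<in> C"
    and rec: "\<And>i j. 1 \<le> i \<Longrightarrow> Suc i < j \<Longrightarrow> j \<le> n \<Longrightarrow> e i j = c i (e (Suc i) j)"
    and far: "\<And>i k. i \<in> {1..<n} \<Longrightarrow> k \<in> {1..<n} \<Longrightarrow> \<bar>int i - int k\<bar> > 1 \<Longrightarrow>
        c k (e i (Suc i)) = e i (Suc i)"
    and near: "\<And>i. 1 \<le> i \<Longrightarrow> Suc i < n \<Longrightarrow>
        c (Suc i) (e i (Suc i)) = c i (e (Suc i) (Suc (Suc i)))"
    and "1 \<le> i" "i < j" "j \<le> n" "k \<in> {1..<n}" "\<not> (k = i \<and> j = Suc i)"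
  shows "c k (e i j) = e (Transposition.transpose k (Suc k) i) (Transposition.transpose k (Suc k) j)"
  using assms(8-12)
proof (induction "j - i" arbitrary: i k rule: less_induct)
  case less
  note prems = less.prems
  let ?t = "Transposition.transpose k (Suc k)"
  show ?case
  proof (cases "j = Suc i")
    case True
    consider "Suc k = i" | "k = Suc i" | "\<bar>int i - int k\<bar> > 1" using True prems by linarith
    then show ?thesis
    proof cases
      case 1
      then show ?thesis using True prems rec[of k j] by (simp add: Transposition.transpose_def)
    next
      case 2
      then show ?thesis
        using True prems rec[of i "Suc (Suc i)"] near[of i] by (simp add: Transposition.transpose_def)
    next
      case 3
      then show ?thesis using True prems far[of i k] by (auto simp: Transposition.transpose_def)
    qed
  next
    case False
    then have ij: "Suc i < j" using prems by simp
    have e: "e i j = c i (e (Suc i) j)" using rec ij prems by simp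
    have m: "e (Suc i) j \<in> C" using mem ij prems by simp
    have i: "i \<in> {1..<n}" using ij prems by simp
    have IH: "c l (e (Suc i) j) =
        e (Transposition.transpose l (Suc l) (Suc i)) (Transposition.transpose l (Suc l) j)"
      if "l \<in> {1..<n}" "\<not> (l = Suc i \<and> j = Suc (Suc i))" for l
      using less.hyps[of "Suc i" l] that ij prems by simp
    consider "Suc k = i" | "k = i" | "k = Suc i" | "\<bar>int k - int i\<bar> > 1" by linarith
    then show ?thesis
    proof cases
      case 1
      then show ?thesis using prems rec[of k j] by (simp add: Transposition.transpose_def)
    next
      case 2
      then show ?thesis using e invol[OF i m] ij by (simp add: Transposition.transpose_def)
    next
      case 3
      show ?thesis
      proof (cases "j = Suc (Suc i)")
        case True
        \<comment> \<open>By \<open>near\<close>, \<open>e i (i+2)\<close> is already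
          \<open>c (i+1)\<close> applied to \<open>e i (i+1)\<close>, so a second application undoes
          it.\<close>
        have "c k (e i j) = c (Suc i) (c (Suc i) (e i (Suc i)))"
          using e True near[of i] 3 prems by simp
        also have "\<dots> = e i (Suc i)" using invol mem 3 prems by simp
        finally show ?thesis using True 3 by (simp add: Transposition.transpose_def)
      next
        case False
        have j: "Suc (Suc i) < j" using False ij by simp
        have m2: "e (Suc (Suc i)) j \<in> C" using mem j prems by simp
        \<comment> \<open>Both \<open>i\<close> and \<open>i+1\<close> lie below the pair
          \<open>(i+2, j)\<close>, so \<open>c i\<close> fixes this element; the braid relation then
          shows that \<open>c (i+1)\<close> fixes \<open>e i j\<close>.\<close>
        have "c i (e (Suc (Suc i)) j) = e (Suc (Suc i)) j"
          using less.hyps[of "Suc (Suc i)" i] i j prems by (simp add: Transposition.transpose_def)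
        then have "c k (e i j) = c i (c (Suc i) (e (Suc (Suc i)) j))"
          using e rec[of "Suc i" j] j 3 prems braid[of i "e (Suc (Suc i)) j"] m2 by simp
        also have "\<dots> = e i j" using e rec[of "Suc i" j] j prems by simp
        finally show ?thesis using 3 j by (simp add: Transposition.transpose_def)
      qed
    next
      case 4
      \<comment> \<open>The swap of \<open>k\<close> and \<open>k+1\<close> fixes \<open>i\<close>
        and \<open>i+1\<close>, so \<open>c k\<close> can pass inside \<open>c i\<close> and act on
        the shorter pair.\<close>
      then have "c k (e i j) = c i (c k (e (Suc i) j))"
        using e comm[of k i] m i prems by simp
      also have "\<dots> = c i (e (Suc i) (?t j))"
        using IH[of k] 4 prems by (auto simp: Transposition.transpose_def)
      also have "\<dots> = e i (?t j)"
        using rec[of i "?t j"] 4 ij prems by (auto simp: Transposition.transpose_def split: if_splits)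
      finally show ?thesis using 4 by (auto simp: Transposition.transpose_def)
    qed
  qed
qed

text \<open>Reversing the order of the indices reduces this to the increasing case.\<close>

lemma adjacent_action_decreasing:
  fixes c :: "nat \<Rightarrow> 'a \<Rightarrow> 'a" and e :: "nat \<Rightarrow> nat \<Rightarrow> 'a"
  assumes invol: "\<And>k x. k \<in> {1..<n} \<Longrightarrow> x \<in> C \<Longrightarrow> c k (c k x) = x"
    and comm: "\<And>k l x. k \<in> {1..<n} \<Longrightarrow> l \<in> {1..<n} \<Longrightarrow> \<bar>int k - int l\<bar> > 1 \<Longrightarrow> x \<in> C \<Longrightarrow>
        c k (c l x) = c l (c k x)"
    and braid: "\<And>k x. 1 \<le> k \<Longrightarrow> Suc k < n \<Longrightarrow> x \<in> C \<Longrightarrow>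
        c (Suc k) (c k (c (Suc k) x)) = c k (c (Suc k) (c k x))"
    and mem: "\<And>i j. 1 \<le> j \<Longrightarrow> j < i \<Longrightarrow> i \<le> n \<Longrightarrow> e i j \<in> C"
    and rec: "\<And>i j. 1 \<le> j \<Longrightarrow> j < i \<Longrightarrow> Suc i \<le> n \<Longrightarrow> e (Suc i) j = c i (e i j)"
    and far: "\<And>i k. i \<in> {1..<n} \<Longrightarrow> k \<in> {1..<n} \<Longrightarrow> \<bar>int i - int k\<bar> > 1 \<Longrightarrow>
        c k (e (Suc i) i) = e (Suc i) i"
    and near: "\<And>i. 1 \<le> i \<Longrightarrow> Suc i < n \<Longrightarrow>
        c (Suc i) (e (Suc i) i) = c i (e (Suc (Suc i)) (Suc i))"
    and "1 \<le> j" "j < i" "i \<le> n" "k \<in> {1..<n}" "\<not> (k = j \<and> i = Suc j)"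
  shows "c k (e i j) = e (Transposition.transpose k (Suc k) i) (Transposition.transpose k (Suc k) j)"
proof -
  \<comment> \<open>This reflection turns the swap of \<open>k\<close> and \<open>k+1\<close> into
    the swap of \<open>n-k\<close> and \<open>n-k+1\<close>, which is why \<open>c\<close> is
    reindexed by \<open>n - k\<close>.\<close>
  let ?r = "\<lambda>i. Suc n - i"
  have flip: "?r (Transposition.transpose (n - k) (Suc (n - k)) (?r i)) = Transposition.transpose k (Suc k) i"
    if "1 \<le> i" "i \<le> n" for i
  proof -
    have k: "1 \<le> k" "k < n" using assms(11) by auto
    consider "i = k" | "i = Suc k" | "i \<noteq> k" "i \<noteq> Suc k" by blast
    then show ?thesis
    proof cases
      case 1
      then have "?r i = Suc (n - k)" using k by simp
      then show ?thesis using 1 k by (simp only: transpose_apply_second transpose_apply_first)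
    next
      case 2
      then have "?r i = n - k" by simp
      then show ?thesis using 2 k by (simp only: transpose_apply_second transpose_apply_first)
    next
      case 3
      have "?r i \<noteq> n - k" "?r i \<noteq> Suc (n - k)" using 3 that k by linarith+
      then show ?thesis using 3 that by (simp add: transpose_apply_other)
    qed
  qed
  have "c (n - (n - k)) (e (?r (?r i)) (?r (?r j))) =
    e (?r (Transposition.transpose (n - k) (Suc (n - k)) (?r i)))
      (?r (Transposition.transpose (n - k) (Suc (n - k)) (?r j)))"
  proof (rule adjacent_action_increasing[where n = n and C = C and c = "\<lambda>k. c (n - k)"
        and e = "\<lambda>i j. e (?r i) (?r j)" and i = "?r i" and j = "?r j" and k = "n - k"])
    show "c (n - Suc k) (c (n - k) (c (n - Suc k) x)) = c (n - k) (c (n - Suc k) (c (n - k) x))"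
      if "1 \<le> k" "Suc k < n" "x \<in> C" for k x
      using braid[of "n - Suc k" x] that by (simp add: Suc_diff_Suc)
    show "e (?r i) (?r j) = c (n - i) (e (?r (Suc i)) (?r j))"
      if "1 \<le> i" "Suc i < j" "j \<le> n" for i j
      using rec[of "?r j" "n - i"] that by (simp add: Suc_diff_le)
    show "c (n - Suc i) (e (?r i) (?r (Suc i))) = c (n - i) (e (?r (Suc i)) (?r (Suc (Suc i))))"
      if "1 \<le> i" "Suc i < n" for i
      using near[of "n - Suc i"] that by (simp add: Suc_diff_Suc Suc_diff_le)
    show "c (n - k) (e (?r i) (?r (Suc i))) = e (?r i) (?r (Suc i))"
      if "i \<in> {1..<n}" "k \<in> {1..<n}" "\<bar>int i - int k\<bar> > 1" for i k
      using far[of "n - i" "n - k"] that by (simp add: Suc_diff_le abs_minus_commute Suc_le_eq)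
    show "c (n - k) (c (n - l) x) = c (n - l) (c (n - k) x)"
      if "k \<in> {1..<n}" "l \<in> {1..<n}" "\<bar>int k - int l\<bar> > 1" "x \<in> C" for k l x
      using comm[of "n - k" "n - l"] that by (simp add: abs_minus_commute Suc_le_eq)
    show "c (n - k) (c (n - k) x) = x" if "k \<in> {1..<n}" "x \<in> C" for k x
      using invol[of "n - k"] that by (simp_all add: Suc_le_eq)
    show "e (?r i) (?r j) \<in> C" if "1 \<le> i" "i < j" "j \<le> n" for i j
      using mem[of "?r j" "?r i"] that by simp
    show "1 \<le> ?r i" "?r i < ?r j" "?r j \<le> n" "n - k \<in> {1..<n}"
      using assms(8-11) by auto
    show "\<not> (n - k = ?r i \<and> ?r j = Suc (?r i))"
      using assms(8-10,12) by linarith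
  qed
  moreover have "n - (n - k) = k" "?r (?r i) = i" "?r (?r j) = j" using assms(8-11) by auto
  moreover have "?r (Transposition.transpose (n - k) (Suc (n - k)) (?r i)) = Transposition.transpose k (Suc k) i"
    "?r (Transposition.transpose (n - k) (Suc (n - k)) (?r j)) = Transposition.transpose k (Suc k) j"
    using flip[of i] flip[of j] assms(8-10) by linarith+
  ultimately show ?thesis by (simp only:)
qed

section \<open>Families of group elements permuted by conjugation\<close>

context group
begin

text \<open>Adjoining \<open>b\<close> to \<open>B\<close> doubles the set, by adding the products
  \<open>w \<otimes> s b\<close> to \<open>W\<close>. The two halves are disjoint: some
  \<open>h\<close> swaps \<open>s a\<close> and \<open>s b\<close> while commuting with the
  \<open>s j\<close> for \<open>j\<close> in \<open>B\<close>, hence with \<open>W\<close>; if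
  \<open>v \<otimes> s b\<close> lay in \<open>W\<close>, its commuting with \<open>h\<close> would
  give \<open>s b = s a\<close>. This is why \<open>a\<close> is kept out of \<open>B\<close>. The
  centraliser clause replaces an explicit description of \<open>W\<close> by subset
  products.\<close>

lemma totally_symmetric_abelian_part:
  assumes H: "subgroup H G" and "finite H" "finite A" "a \<in> A"
    and mem: "\<And>j. j \<in> A \<Longrightarrow> s j \<in> H"
    and inj: "inj_on s A"
    and sym: "\<And>p. p permutes A \<Longrightarrow> \<exists>h\<in>H. \<forall>j\<in>A. h \<otimes> s j = s (p j) \<otimes> h"
    and "B \<subseteq> A - {a}"
  shows "\<exists>W\<subseteq>H. card W = 2 ^ card B \<and>
    (\<forall>w\<in>W. \<forall>g\<in>carrier G. (\<forall>j\<in>B. g \<otimes> s j = s j \<otimes> g) \<longrightarrow> g \<otimes> w = w \<otimes> g)"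
proof -
  have HG: "x \<in> carrier G" if "x \<in> H" for x using that H by (rule subgroup.mem_carrier[rotated])
  have "finite B" using assms(3,8) by (meson finite_Diff finite_subset)
  then show ?thesis
    using assms(8)
  proof (induction B rule: finite_induct)
    case empty
    have "{\<one>} \<subseteq> H" using subgroup.one_closed[OF H] by simp
    then show ?case by (intro exI[of _ "{\<one>}"]) auto
  next
    case (insert b B)
    then obtain W where W: "W \<subseteq> H" "card W = 2 ^ card B"
      and cen: "\<And>w g. w \<in> W \<Longrightarrow> g \<in> carrier G \<Longrightarrow> (\<forall>j\<in>B. g \<otimes> s j = s j \<otimes> g) \<Longrightarrow> g \<otimes> w = w \<otimes> g"
      by auto
    have b: "b \<in> A" "b \<noteq> a" "b \<notin> B" and B: "B \<subseteq> A - {a}" using insert by auto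
    have sb: "s b \<in> carrier G" "s a \<in> carrier G" using mem HG b assms(4) by auto
    have finW: "finite W" using W(1) assms(2) finite_subset by blast
    let ?V = "(\<lambda>w. w \<otimes> s b) ` W"
    have inj': "inj_on (\<lambda>w. w \<otimes> s b) W"
      using W(1) HG sb by (intro inj_onI) (metis right_cancel subsetD)
    obtain h where h: "h \<in> H" "\<And>j. j \<in> A \<Longrightarrow> h \<otimes> s j = s (Transposition.transpose a b j) \<otimes> h"
      using sym[of "Transposition.transpose a b"] assms(4) b permutes_swap_id[of a A b] by blast
    have hB: "\<forall>j\<in>B. h \<otimes> s j = s j \<otimes> h"
    proof
      fix j assume "j \<in> B"
      then have "j \<in> A" "j \<noteq> a" "j \<noteq> b" using B b(3) by auto
      then show "h \<otimes> s j = s j \<otimes> h" using h(2)[of j] by (simp add: Transposition.transpose_def)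
    qed
    have hc: "h \<in> carrier G" using h HG by simp
    have "W \<inter> ?V = {}"
    proof (rule ccontr)
      assume "W \<inter> ?V \<noteq> {}"
      then obtain w v where wv: "w \<in> W" "v \<in> W" "w = v \<otimes> s b" by blast
      have c: "w \<in> carrier G" "v \<in> carrier G" using wv(1,2) W(1) HG by auto
      have "v \<otimes> s b \<otimes> h = h \<otimes> (v \<otimes> s b)" using cen[OF wv(1) hc hB] wv(3) by simp
      also have "\<dots> = v \<otimes> (h \<otimes> s b)" using cen[OF wv(2) hc hB] c sb hc by (simp add: m_assoc[symmetric])
      also have "\<dots> = v \<otimes> s a \<otimes> h" using h(2)[of b] b c sb hc by (simp add: m_assoc)
      finally have "s b = s a" using c sb hc by simp
      then show False using inj b assms(4) by (auto dest: inj_onD)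
    qed
    then have "card (W \<union> ?V) = 2 ^ card (insert b B)"
      using finW W(2) insert.hyps card_image[OF inj'] by (simp add: card_Un_disjoint)
    moreover have "W \<union> ?V \<subseteq> H" using W(1) mem b subgroup.m_closed[OF H] by auto
    moreover have "g \<otimes> w = w \<otimes> g"
      if w: "w \<in> W \<union> ?V" and g: "g \<in> carrier G" "\<forall>j\<in>insert b B. g \<otimes> s j = s j \<otimes> g" for w g
      using w
    proof
      assume "w \<in> ?V"
      then obtain v where v: "v \<in> W" "w = v \<otimes> s b" by blast
      have c: "v \<in> carrier G" using v W(1) HG by auto
      have "g \<otimes> w = (g \<otimes> v) \<otimes> s b" using v g c sb by (simp add: m_assoc)
      also have "\<dots> = v \<otimes> (g \<otimes> s b)" using cen[OF v(1) g(1)] g c sb by (simp add: m_assoc)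
      also have "\<dots> = w \<otimes> g" using v g c sb by (simp add: m_assoc)
      finally show ?thesis .
    qed (use cen g in auto)
    ultimately show ?case by (intro exI[of _ "W \<union> ?V"]) blast
  qed
qed

text \<open>Members of \<open>W\<close> centralise the family, so \<open>h p \<otimes> w\<close>
  acts on it by \<open>p\<close>. As \<open>s\<close> is injective, this product determines
  \<open>p\<close> and then, by cancelling, \<open>w\<close>; the pairs \<open>(p, w)\<close> thus
  embed in \<open>H\<close>.\<close>

lemma totally_symmetric_card_le:
  assumes H: "subgroup H G" and "finite H" "finite A" "A \<noteq> {}"
    and mem: "\<And>j. j \<in> A \<Longrightarrow> s j \<in> H"
    and comm: "\<And>i j. i \<in> A \<Longrightarrow> j \<in> A \<Longrightarrow> s i \<otimes> s j = s j \<otimes> s i"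
    and inj: "inj_on s A"
    and sym: "\<And>p. p permutes A \<Longrightarrow> \<exists>h\<in>H. \<forall>j\<in>A. h \<otimes> s j = s (p j) \<otimes> h"
  shows "2 ^ (card A - 1) * fact (card A) \<le> card H"
proof -
  obtain a where a: "a \<in> A" using assms(4) by blast
  have HG: "x \<in> carrier G" if "x \<in> H" for x using that H by (rule subgroup.mem_carrier[rotated])
  obtain W where W: "W \<subseteq> H" "card W = 2 ^ card (A - {a})"
    and cen: "\<And>w g. w \<in> W \<Longrightarrow> g \<in> carrier G \<Longrightarrow> (\<forall>j\<in>A-{a}. g \<otimes> s j = s j \<otimes> g) \<Longrightarrow> g \<otimes> w = w \<otimes> g"
    using totally_symmetric_abelian_part[OF H assms(2,3) a mem inj sym, of "A - {a}"] by auto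
  obtain h where h: "\<And>p. p permutes A \<Longrightarrow> h p \<in> H"
      "\<And>p j. p permutes A \<Longrightarrow> j \<in> A \<Longrightarrow> h p \<otimes> s j = s (p j) \<otimes> h p"
    using sym by metis
  have act: "h p \<otimes> w \<otimes> s j = s (p j) \<otimes> (h p \<otimes> w)"
    if "p permutes A" "w \<in> W" "j \<in> A" for p w j
  proof -
    have c: "h p \<in> carrier G" "w \<in> carrier G" "s j \<in> carrier G" "s (p j) \<in> carrier G"
      using that h(1) W(1) mem HG permutes_in_image[OF that(1)] by auto
    \<comment> \<open>Commutativity of the family lets \<open>s j\<close> itself take the place of
      the centralising element \<open>g\<close>.\<close>
    have "s j \<otimes> w = w \<otimes> s j" using cen[OF that(2) c(3)] comm that(3) by auto
    then have "h p \<otimes> w \<otimes> s j = h p \<otimes> s j \<otimes> w" using c by (simp add: m_assoc)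
    then show ?thesis using h(2)[OF that(1,3)] c by (simp add: m_assoc)
  qed
  have "inj_on (\<lambda>(p, w). h p \<otimes> w) ({p. p permutes A} \<times> W)"
  proof (rule inj_onI, clarify)
    fix p w q v
    assume pq: "p permutes A" "q permutes A" and wv: "w \<in> W" "v \<in> W" and eq: "h p \<otimes> w = h q \<otimes> v"
    have c: "h p \<in> carrier G" "w \<in> carrier G" "v \<in> carrier G" using pq wv W(1) h(1) HG by auto
    have "p j = q j" if j: "j \<in> A" for j
    proof -
      have m: "p j \<in> A" "q j \<in> A" using pq j by (simp_all add: permutes_in_image)
      have "s (p j) \<otimes> (h p \<otimes> w) = s (q j) \<otimes> (h p \<otimes> w)"
        using act[OF pq(1) wv(1) j] act[OF pq(2) wv(2) j] eq by simp
      then have "s (p j) = s (q j)" using c m mem HG by simp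
      then show ?thesis using inj m by (auto dest: inj_onD)
    qed
    then have "p = q" using pq by (metis ext permutes_not_in)
    then show "p = q \<and> w = v" using eq c by simp
  qed
  moreover have "(\<lambda>(p, w). h p \<otimes> w) ` ({p. p permutes A} \<times> W) \<subseteq> H"
    using h(1) W(1) subgroup.m_closed[OF H] by auto
  ultimately have "card ({p. p permutes A} \<times> W) \<le> card H"
    using assms(2) by (metis card_inj_on_le)
  then show ?thesis
    using W(2) a assms(3) card_permutations[OF HOL.refl assms(3)] by (simp add: card_cartesian_product mult.commute)
qed

text \<open>Conjugation by \<open>h\<close> is an automorphism. Writing it as
  \<open>h \<otimes> u = u' \<otimes> h\<close> avoids inverses; the same form describes how
  permutations act on a family.\<close>

lemma commute_transfer:
  assumes "u \<otimes> v = v \<otimes> u" "h \<otimes> u = u' \<otimes> h" "h \<otimes> v = v' \<otimes> h"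
    and c: "h \<in> carrier G" "u \<in> carrier G" "v \<in> carrier G" "u' \<in> carrier G" "v' \<in> carrier G"
  shows "u' \<otimes> v' = v' \<otimes> u'"
proof -
  have "u' \<otimes> v' \<otimes> h = u' \<otimes> (h \<otimes> v)" using assms(3) c by (simp add: m_assoc)
  also have "\<dots> = h \<otimes> u \<otimes> v" using assms(2) c by (simp add: m_assoc[symmetric])
  also have "\<dots> = h \<otimes> v \<otimes> u" using assms(1) c by (simp add: m_assoc)
  also have "\<dots> = v' \<otimes> (h \<otimes> u)" using assms(3) c by (simp add: m_assoc)
  also have "\<dots> = v' \<otimes> u' \<otimes> h" using assms(2) c by (simp add: m_assoc)
  finally show ?thesis using c by simp
qed

text \<open>The symmetric group is doubly transitive: one coincidence \<open>s a = s b\<close> is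
  carried to every pair of distinct indices, so a family that is not injective is constant.\<close>

lemma totally_symmetric_dichotomy:
  assumes H: "subgroup H G" and "finite H" "finite A" "A \<noteq> {}"
    and mem: "\<And>j. j \<in> A \<Longrightarrow> s j \<in> H"
    and comm: "\<And>i j. i \<in> A \<Longrightarrow> j \<in> A \<Longrightarrow> s i \<otimes> s j = s j \<otimes> s i"
    and sym: "\<And>p. p permutes A \<Longrightarrow> \<exists>h\<in>H. \<forall>j\<in>A. h \<otimes> s j = s (p j) \<otimes> h"
  shows "(\<forall>i\<in>A. \<forall>j\<in>A. s i = s j) \<or> 2 ^ (card A - 1) * fact (card A) \<le> card H"
proof (cases "inj_on s A")
  case True
  then show ?thesis using totally_symmetric_card_le[OF assms(1-6) True sym] by blast
next
  case False
  then obtain a b where ab: "a \<in> A" "b \<in> A" "a \<noteq> b" "s a = s b" by (auto simp: inj_on_def)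
  have "s i = s j" if ij: "i \<in> A" "j \<in> A" "i \<noteq> j" for i j
  proof -
    obtain p where p: "p permutes A" "map p [a, b] = [i, j]"
      using permutes_extending_list[of "[a, b]" "[i, j]" A] ab ij by auto
    obtain h where h: "h \<in> H" "\<forall>j\<in>A. h \<otimes> s j = s (p j) \<otimes> h" using sym[OF p(1)] by blast
    have "s i \<otimes> h = s j \<otimes> h" using h(2) ab p(2) by (metis list.map(2) list.inject)
    then show ?thesis using h(1) mem[OF ij(1)] mem[OF ij(2)] subgroup.mem_carrier[OF H] by simp
  qed
  then show ?thesis by metis
qed

end

lemma cyclic_hom_subgroup_generated:
  fixes K :: "('a, 'c) monoid_scheme" and G :: "('b, 'd) monoid_scheme"
  assumes "group K" "group G" "\<phi> \<in> hom K G" "Y \<subseteq> carrier K" "\<phi> ` Y = {c}"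
  shows "cyclic_hom (subgroup_generated K Y) G \<phi>"
proof -
  interpret group_hom K G \<phi>
    using assms by (simp add: group_hom_def group_hom_axioms_def)
  have c: "c \<in> carrier G" using assms(4,5) by (metis hom_closed image_iff insertI1 subsetD)
  have "carrier (subgroup_generated K Y) = generate K Y"
    using assms(4) by (simp add: carrier_subgroup_generated Int_absorb1)
  then have img: "\<phi> ` carrier (subgroup_generated K Y) = generate G {c}"
    using generate_img[OF assms(4)] assms(5) by simp
  \<comment> \<open>\<open>cyclic_group\<close> forms the generated subgroup inside the image rather
    than in \<open>G\<close>; the two closures have to be matched.\<close>
  have "generate (G\<lparr>carrier := generate G {c}\<rparr>) {c} = generate G {c}"
    using c by (intro H.generate_consistent) (auto intro: generate.incl H.generate_is_subgroup)
  moreover have "c \<in> generate G {c}" by (simp add: generate.incl)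
  ultimately show ?thesis
    unfolding cyclic_hom_def cyclic_group_def hom_image_def img
    by (intro bexI[of _ c]) (simp_all add: subgroup_generated_def)
qed

section \<open>The relations of the welded braid group in \<open>G\<close>\<close>

locale wB_representation = group G for G (structure) +
  fixes n :: nat and \<phi>
  assumes hom: "\<phi> \<in> hom (wB n) G"
begin

text \<open>Evaluating words turns each defining relation into an equation in \<open>G\<close>,
  without handling classes.\<close>

definition ev :: "braid_gen group_word \<Rightarrow> 'a" where
  "ev w = \<phi> (pres_rel (braid_gens n) (wB_rels n) `` {w})"

abbreviation "words \<equiv> group_words (braid_gens n)"
abbreviation "T k \<equiv> ev [tu k]"
abbreviation "S k \<equiv> ev [sg k]"
abbreviation "conj_T k x \<equiv> T k \<otimes> x \<otimes> T k"
abbreviation "s i j \<equiv> ev (sigma_word i j)"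
abbreviation "H \<equiv> \<phi> ` carrier (wB n)"

lemma gens [simp]:
  "Sigma_gen k \<in> braid_gens n \<longleftrightarrow> k \<in> {1..<n}" "Tau_gen k \<in> braid_gens n \<longleftrightarrow> k \<in> {1..<n}"
  by (auto simp: braid_gens_def)

lemma map_tu_words [simp]: "map tu xs \<in> words \<longleftrightarrow> set xs \<subseteq> {1..<n}"
  by (induction xs) auto

lemma sigma_word_words:
  "i \<in> {1..n} \<Longrightarrow> j \<in> {1..n} \<Longrightarrow> i \<noteq> j \<Longrightarrow> sigma_word i j \<in> words"
  by (auto simp: sigma_word_def)

lemma subgroup_H: "subgroup H G"
proof -
  interpret group_hom "wB n" G \<phi>
    using hom group_wB by (simp add: group_hom_def group_hom_axioms_def is_group)
  show ?thesis by (rule img_is_subgroup)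
qed

lemma H_carrier: "x \<in> H \<Longrightarrow> x \<in> carrier G"
  using subgroup.mem_carrier[OF subgroup_H] .

lemma ev_H: "w \<in> words \<Longrightarrow> ev w \<in> H"
  unfolding ev_def wB_def by (intro imageI presented_group_class)

lemma ev_closed [simp]: "w \<in> words \<Longrightarrow> ev w \<in> carrier G"
  using ev_H H_carrier by blast

lemma ev_append: "u \<in> words \<Longrightarrow> v \<in> words \<Longrightarrow> ev (u @ v) = ev u \<otimes> ev v"
  using hom_mult[OF hom, of "pres_rel (braid_gens n) (wB_rels n) `` {u}" "pres_rel (braid_gens n) (wB_rels n) `` {v}"]
  unfolding ev_def wB_def by (simp add: presented_group_class presented_group_mult)

lemma ev_Nil [simp]: "ev [] = \<one>"
  using ev_append[of "[]" "[]"] by simp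

text \<open>Asking for two leading letters keeps rewriting from looping on one-letter words.\<close>

lemma ev_Cons: "a # b # w \<in> words \<Longrightarrow> ev (a # b # w) = ev [a] \<otimes> ev (b # w)"
  using ev_append[of "[a]" "b # w"] by simp

lemma ev_tu_conj:
  "w \<in> words \<Longrightarrow> k \<in> {1..<n} \<Longrightarrow> ev ([tu k] @ w @ [tu k]) = conj_T k (ev w)"
  using ev_append[of "[tu k]" "w @ [tu k]"] ev_append[of w "[tu k]"] by (simp add: m_assoc)

lemma ev_rel:
  assumes "(l, r) \<in> wB_rels n" "l \<in> words" "r \<in> words"
  shows "ev l = ev r"
proof -
  have "([] @ l @ [], [] @ r @ []) \<in> pres_rel (braid_gens n) (wB_rels n)"
    using assms by (intro pres_rel.relation) auto
  then show ?thesis unfolding ev_def by (simp add: equiv_class_eq[OF equiv_pres_rel])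
qed

lemma T_T: "k \<in> {1..<n} \<Longrightarrow> T k \<otimes> T k = \<one>"
  using ev_rel[of "[tu k, tu k]" "[]"] by (auto simp: wB_rels_def vB_rels_def ev_Cons)

lemma T_T_left: "k \<in> {1..<n} \<Longrightarrow> x \<in> carrier G \<Longrightarrow> T k \<otimes> (T k \<otimes> x) = x"
  by (simp add: m_assoc[symmetric] T_T)

lemma far_commute:
  assumes "k \<in> {1..<n}" "l \<in> {1..<n}" "\<bar>int k - int l\<bar> > 1"
  shows "S k \<otimes> S l = S l \<otimes> S k" "T k \<otimes> T l = T l \<otimes> T k" "S k \<otimes> T l = T l \<otimes> S k"
proof -
  have k: "k \<in> {1..n-1}" "l \<in> {1..n-1}" using assms by auto
  have "([sg k, sg l], [sg l, sg k]) \<in> wB_rels n" "([tu k, tu l], [tu l, tu k]) \<in> wB_rels n"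
    "([sg k, tu l], [tu l, sg k]) \<in> wB_rels n"
    using k assms(3) unfolding wB_rels_def vB_rels_def by blast+
  from this[THEN ev_rel]
  show "S k \<otimes> S l = S l \<otimes> S k" "T k \<otimes> T l = T l \<otimes> T k" "S k \<otimes> T l = T l \<otimes> S k"
    using assms by (simp_all add: ev_Cons)
qed

text \<open>In order: the braid relation of the \<open>T k\<close>, the mixed relation, and the
  welded relation, which is behind the commutation within a row.\<close>

lemma near_relations:
  assumes "1 \<le> k" "Suc k < n"
  shows "T k \<otimes> (T (Suc k) \<otimes> T k) = T (Suc k) \<otimes> (T k \<otimes> T (Suc k))"
    and "T (Suc k) \<otimes> (S k \<otimes> T (Suc k)) = T k \<otimes> (S (Suc k) \<otimes> T k)"
    and "T k \<otimes> (S (Suc k) \<otimes> S k) = S (Suc k) \<otimes> (S k \<otimes> T (Suc k))"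
proof -
  have k: "k \<in> {1..n-2}" using assms by auto
  have "([tu k, tu (k+1), tu k], [tu (k+1), tu k, tu (k+1)]) \<in> wB_rels n"
    "([tu (k+1), sg k, tu (k+1)], [tu k, sg (k+1), tu k]) \<in> wB_rels n"
    "([tu k, sg (k+1), sg k], [sg (k+1), sg k, tu (k+1)]) \<in> wB_rels n"
    using k unfolding wB_rels_def vB_rels_def by blast+
  from this[THEN ev_rel]
  show "T k \<otimes> (T (Suc k) \<otimes> T k) = T (Suc k) \<otimes> (T k \<otimes> T (Suc k))"
    "T (Suc k) \<otimes> (S k \<otimes> T (Suc k)) = T k \<otimes> (S (Suc k) \<otimes> T k)"
    "T k \<otimes> (S (Suc k) \<otimes> S k) = S (Suc k) \<otimes> (S k \<otimes> T (Suc k))"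
    using assms by (simp_all add: ev_Cons)
qed

section \<open>Conjugation by the \<open>T k\<close> permutes the indices\<close>

lemma sigma_base:
  assumes "k \<in> {1..<n}"
  shows "s k (Suc k) = T k \<otimes> S k" "s (Suc k) k = S k \<otimes> T k"
  using assms by (simp_all add: sigma_word_def ev_Cons)

lemma sigma_step_increasing:
  assumes "1 \<le> i" "Suc i < j" "j \<le> n"
  shows "s i j = conj_T i (s (Suc i) j)"
proof -
  have "[i..<j-1] = i # [Suc i..<j-1]" using assms by (simp add: upt_conv_Cons)
  then have "sigma_word i j = [tu i] @ sigma_word (Suc i) j @ [tu i]"
    using assms by (simp add: sigma_word_def)
  moreover have "sigma_word (Suc i) j \<in> words" using assms by (intro sigma_word_words) auto
  ultimately show ?thesis using assms ev_tu_conj[of "sigma_word (Suc i) j" i] by simp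
qed

lemma sigma_step_decreasing:
  assumes "1 \<le> j" "j < i" "Suc i \<le> n"
  shows "s (Suc i) j = conj_T i (s i j)"
proof -
  have "sigma_word (Suc i) j = [tu i] @ sigma_word i j @ [tu i]"
    using assms by (simp add: sigma_word_def)
  moreover have "sigma_word i j \<in> words" using assms by (intro sigma_word_words) auto
  ultimately show ?thesis using assms ev_tu_conj[of "sigma_word i j" i] by simp
qed

lemma conj_simps:
  assumes "k \<in> {1..<n}" "x \<in> carrier G"
  shows "conj_T k x \<in> carrier G" "conj_T k (conj_T k x) = x"
  using assms by (simp_all add: m_assoc T_T T_T_left)

lemma conj_commute:
  assumes "k \<in> {1..<n}" "l \<in> {1..<n}" "\<bar>int k - int l\<bar> > 1" "x \<in> carrier G"
  shows "conj_T k (conj_T l x) = conj_T l (conj_T k x)"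
proof -
  have "conj_T k (conj_T l x) = (T k \<otimes> T l) \<otimes> x \<otimes> (T l \<otimes> T k)" using assms by (simp add: m_assoc)
  also have "\<dots> = (T l \<otimes> T k) \<otimes> x \<otimes> (T k \<otimes> T l)" using far_commute(2)[OF assms(1-3)] by simp
  also have "\<dots> = conj_T l (conj_T k x)" using assms by (simp add: m_assoc)
  finally show ?thesis .
qed

lemma conj_braid:
  assumes "1 \<le> k" "Suc k < n" "x \<in> carrier G"
  shows "conj_T (Suc k) (conj_T k (conj_T (Suc k) x)) = conj_T k (conj_T (Suc k) (conj_T k x))"
proof -
  let ?u = "T k \<otimes> (T (Suc k) \<otimes> T k)" and ?v = "T (Suc k) \<otimes> (T k \<otimes> T (Suc k))"
  have "conj_T (Suc k) (conj_T k (conj_T (Suc k) x)) = ?v \<otimes> x \<otimes> ?v" using assms by (simp add: m_assoc)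
  also have "\<dots> = ?u \<otimes> x \<otimes> ?u" using near_relations(1)[OF assms(1,2)] by simp
  also have "\<dots> = conj_T k (conj_T (Suc k) (conj_T k x))" using assms by (simp add: m_assoc)
  finally show ?thesis .
qed

text \<open>Inserting \<open>T (Suc k) \<otimes> T (Suc k)\<close> between \<open>T k\<close> and
  \<open>S k\<close> splits the left side into a braid word in the \<open>T\<close>s and one side of
  the mixed relation.\<close>

lemma conj_near_increasing:
  assumes "1 \<le> k" "Suc k < n"
  shows "conj_T (Suc k) (s k (Suc k)) = conj_T k (s (Suc k) (Suc (Suc k)))"
proof -
  have c: "T k \<in> carrier G" "T (Suc k) \<in> carrier G" "S k \<in> carrier G" "S (Suc k) \<in> carrier G"
    using assms by simp_all
  have [simp]: "T (Suc k) \<otimes> (T (Suc k) \<otimes> x) = x" "T k \<otimes> (T k \<otimes> x) = x" if "x \<in> carrier G" for x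
    using that assms T_T_left by simp_all
  have "conj_T (Suc k) (s k (Suc k)) = T (Suc k) \<otimes> (T k \<otimes> T (Suc k)) \<otimes> (T (Suc k) \<otimes> (S k \<otimes> T (Suc k)))"
    using assms c by (simp add: sigma_base m_assoc)
  also have "\<dots> = T k \<otimes> (T (Suc k) \<otimes> T k) \<otimes> (T k \<otimes> (S (Suc k) \<otimes> T k))"
    using near_relations[OF assms] by simp
  also have "\<dots> = conj_T k (s (Suc k) (Suc (Suc k)))"
    using assms c by (simp add: sigma_base m_assoc)
  finally show ?thesis .
qed

lemma conj_swap:
  assumes "k \<in> {1..<n}"
  shows "conj_T k (s k (Suc k)) = s (Suc k) k" "conj_T k (s (Suc k) k) = s k (Suc k)"
  using assms by (simp_all add: sigma_base m_assoc T_T T_T_left)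

text \<open>This follows from the increasing case: apply \<open>conj_T (Suc k)\<close> and then
  \<open>conj_T k\<close> to \<open>e\<close>, shorten by the braid relation, and reverse both index
  pairs with \<open>conj_swap\<close>.\<close>

lemma conj_near_decreasing:
  assumes "1 \<le> k" "Suc k < n"
  shows "conj_T (Suc k) (s (Suc k) k) = conj_T k (s (Suc (Suc k)) (Suc k))"
proof -
  have k: "k \<in> {1..<n}" "Suc k \<in> {1..<n}" using assms by auto
  have c: "s k (Suc k) \<in> carrier G" "s (Suc k) (Suc (Suc k)) \<in> carrier G"
    using assms by (simp_all add: sigma_word_words)
  have e: "conj_T k (conj_T (Suc k) (s k (Suc k))) = s (Suc k) (Suc (Suc k))"
    using conj_near_increasing[OF assms] conj_simps(2)[OF k(1) c(2)] by simp
  have "conj_T k (conj_T (Suc k) (conj_T k (conj_T (Suc k) (s k (Suc k)))))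
      = conj_T (Suc k) (conj_T k (conj_T (Suc k) (conj_T (Suc k) (s k (Suc k)))))"
    using conj_braid[OF assms conj_simps(1)[OF k(2) c(1)]] by simp
  then have "conj_T k (conj_T (Suc k) (s (Suc k) (Suc (Suc k)))) = conj_T (Suc k) (conj_T k (s k (Suc k)))"
    using e conj_simps(2)[OF k(2) c(1)] by simp
  then show ?thesis using conj_swap(1) k by simp
qed

lemma conj_far:
  assumes "i \<in> {1..<n}" "k \<in> {1..<n}" "\<bar>int i - int k\<bar> > 1"
  shows "conj_T k (s i (Suc i)) = s i (Suc i)" "conj_T k (s (Suc i) i) = s (Suc i) i"
proof -
  have c: "S i \<in> carrier G" "T i \<in> carrier G" "T k \<in> carrier G" using assms by simp_all
  have S: "S i \<otimes> T k = T k \<otimes> S i" and T: "T i \<otimes> T k = T k \<otimes> T i"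
    using far_commute(2,3)[OF assms] by auto
  have "(T i \<otimes> S i) \<otimes> T k = T k \<otimes> (T i \<otimes> S i)" "(S i \<otimes> T i) \<otimes> T k = T k \<otimes> (S i \<otimes> T i)"
    using S T c by (metis m_assoc)+
  then show "conj_T k (s i (Suc i)) = s i (Suc i)" "conj_T k (s (Suc i) i) = s (Suc i) i"
    using assms c by (simp_all add: sigma_base m_assoc T_T_left)
qed

lemma conj_sigma:
  assumes "i \<in> {1..n}" "j \<in> {1..n}" "i \<noteq> j" "k \<in> {1..<n}"
  shows "conj_T k (s i j) = s (Transposition.transpose k (Suc k) i) (Transposition.transpose k (Suc k) j)"
proof (cases "(k = i \<and> j = Suc i) \<or> (k = j \<and> i = Suc j)")
  \<comment> \<open>This swap, reversing an adjacent pair, is the case that the two abstract lemmas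
    leave out.\<close>
  case True
  then show ?thesis using conj_swap assms by auto
next
  case False
  have mem: "s i j \<in> carrier G" if "1 \<le> i" "1 \<le> j" "i \<noteq> j" "i \<le> n" "j \<le> n" for i j
    using that by (simp add: sigma_word_words)
  have inc: "s i j \<in> carrier G" and dec: "s j i \<in> carrier G" if "1 \<le> i" "i < j" "j \<le> n" for i j
    using that mem by simp_all
  note conj_rules = conj_simps conj_commute conj_braid conj_far
  show ?thesis
  proof (cases "i < j")
    case True
    show ?thesis
      by (rule adjacent_action_increasing[where C = "carrier G" and n = n and c = "\<lambda>k x. conj_T k x" and e = "\<lambda>i j. s i j"])
        ((rule conj_rules conj_near_increasing sigma_step_increasing inc; assumption) |
         (use assms True False in simp))+
  next
    case ge: False
    show ?thesis
      by (rule adjacent_action_decreasing[where C = "carrier G" and n = n and c = "\<lambda>k x. conj_T k x" and e = "\<lambda>i j. s i j"])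
        ((rule conj_rules conj_near_decreasing sigma_step_decreasing dec; assumption) |
         (use assms ge False in simp))+
  qed
qed

text \<open>Adjacent transpositions are realised by the \<open>T k\<close>, and being realised
  passes to products. Some \<open>h\<close> for each \<open>p\<close> is enough for counting, so no
  homomorphism from the symmetric group is built.\<close>

lemma permutation_action:
  assumes "p permutes {1..n}"
  obtains h where "h \<in> H"
    "\<And>i j. i \<in> {1..n} \<Longrightarrow> j \<in> {1..n} \<Longrightarrow> i \<noteq> j \<Longrightarrow> h \<otimes> s i j = s (p i) (p j) \<otimes> h"
proof -
  have "\<exists>h\<in>H. \<forall>i\<in>{1..n}. \<forall>j\<in>{1..n}. i \<noteq> j \<longrightarrow> h \<otimes> s i j = s (p i) (p j) \<otimes> h" (is "?P p")
    using assms
  proof (rule adjacent_transpositions_generate)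
    show "?P id"
      using subgroup.one_closed[OF subgroup_H] by (intro bexI[of _ \<one>]) (auto simp: sigma_word_words)
  next
    fix p q assume p: "?P p" "p permutes {1..n}" and q: "?P q" "q permutes {1..n}"
    obtain g where g: "g \<in> H" "\<And>i j. i \<in> {1..n} \<Longrightarrow> j \<in> {1..n} \<Longrightarrow> i \<noteq> j \<Longrightarrow> g \<otimes> s i j = s (p i) (p j) \<otimes> g"
      using p(1) by blast
    obtain h where h: "h \<in> H" "\<And>i j. i \<in> {1..n} \<Longrightarrow> j \<in> {1..n} \<Longrightarrow> i \<noteq> j \<Longrightarrow> h \<otimes> s i j = s (q i) (q j) \<otimes> h"
      using q(1) by blast
    have "(g \<otimes> h) \<otimes> s i j = s ((p \<circ> q) i) ((p \<circ> q) j) \<otimes> (g \<otimes> h)"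
      if ij: "i \<in> {1..n}" "j \<in> {1..n}" "i \<noteq> j" for i j
    proof -
      have q': "q i \<in> {1..n}" "q j \<in> {1..n}" "q i \<noteq> q j"
        using ij permutes_in_image[OF q(2)] permutes_inj[OF q(2)] by (auto dest: injD)
      have p': "p (q i) \<in> {1..n}" "p (q j) \<in> {1..n}" "p (q i) \<noteq> p (q j)"
        using q' permutes_in_image[OF p(2)] permutes_inj[OF p(2)] by (auto dest: injD)
      have c: "g \<in> carrier G" "h \<in> carrier G" "s i j \<in> carrier G" "s (q i) (q j) \<in> carrier G"
        "s (p (q i)) (p (q j)) \<in> carrier G"
        using g(1) h(1) H_carrier ij q' p' by (blast intro: ev_closed sigma_word_words)+
      have "(g \<otimes> h) \<otimes> s i j = (g \<otimes> s (q i) (q j)) \<otimes> h" using h(2)[OF ij] c by (simp add: m_assoc)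
      also have "\<dots> = s ((p \<circ> q) i) ((p \<circ> q) j) \<otimes> (g \<otimes> h)" using g(2)[OF q'] c by (simp add: m_assoc)
      finally show ?thesis .
    qed
    then show "?P (p \<circ> q)" using subgroup.m_closed[OF subgroup_H g(1) h(1)] by blast
  next
    fix k assume k: "k \<in> {1..<n}"
    let ?t = "Transposition.transpose k (Suc k)"
    have "T k \<otimes> s i j = s (?t i) (?t j) \<otimes> T k" if ij: "i \<in> {1..n}" "j \<in> {1..n}" "i \<noteq> j" for i j
    proof -
      have "conj_T k (s i j) \<otimes> T k = T k \<otimes> s i j"
        using k sigma_word_words[OF ij] by (simp add: m_assoc T_T)
      then show ?thesis using conj_sigma[OF ij k] by simp
    qed
    then show "?P ?t" using ev_H[of "[tu k]"] k by (intro bexI[of _ "T k"]) auto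
  qed
  then show ?thesis using that by blast
qed

section \<open>Commutation among the \<open>s i j\<close>\<close>

lemma sigma_closed: "i \<in> {1..n} \<Longrightarrow> j \<in> {1..n} \<Longrightarrow> i \<noteq> j \<Longrightarrow> s i j \<in> carrier G"
  by (simp add: sigma_word_words)

text \<open>Both products equal \<open>x \<otimes> (y \<otimes> (b \<otimes> a))\<close>. For
  \<open>s 1 3 \<otimes> s 1 2\<close> this is the cancellation of \<open>x \<otimes> x\<close>; for
  the other order the welded relation enters, through \<open>b \<otimes> a\<close>.\<close>

lemma sigma_commute_base:
  assumes "3 \<le> n"
  shows "s 1 2 \<otimes> s 1 3 = s 1 3 \<otimes> s 1 2"
proof -
  define x y a b where "x = T 1" and "y = T 2" and "a = S 1" and "b = S 2"
  note defs = x_def y_def a_def b_def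
  have c [simp]: "x \<in> carrier G" "y \<in> carrier G" "a \<in> carrier G" "b \<in> carrier G"
    using assms by (simp_all add: defs)
  have xx: "x \<otimes> x = \<one>" and yy: "y \<otimes> y = \<one>"
    using assms T_T[of 1] T_T[of 2] by (simp_all add: defs)
  have sq [simp]: "x \<otimes> (x \<otimes> z) = z" "y \<otimes> (y \<otimes> z) = z" if "z \<in> carrier G" for z
    using that by (simp_all add: m_assoc[symmetric] xx yy)
  have rels: "x \<otimes> (y \<otimes> x) = y \<otimes> (x \<otimes> y)" "y \<otimes> (a \<otimes> y) = x \<otimes> (b \<otimes> x)"
      "x \<otimes> (b \<otimes> a) = b \<otimes> (a \<otimes> y)"
    using near_relations[of 1] assms by (simp_all add: defs numeral_2_eq_2)
  have s12: "s 1 2 = x \<otimes> a" using sigma_base(1)[of 1] assms by (simp add: defs numeral_2_eq_2)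
  have "s 1 3 = conj_T 1 (s 2 3)"
    using sigma_step_increasing[of 1 3] assms by (simp add: numeral_2_eq_2)
  then have s13: "s 1 3 = x \<otimes> (y \<otimes> b) \<otimes> x"
    using sigma_base(1)[of 2] assms by (simp add: defs numeral_3_eq_3 numeral_2_eq_2)
  \<comment> \<open>The mixed relation expresses \<open>b\<close> by \<open>a\<close>, namely
    \<open>b = xyayx\<close>.\<close>
  have bx: "b \<otimes> x = x \<otimes> (y \<otimes> (a \<otimes> y))" using rels(2) by simp
  have "b = (b \<otimes> x) \<otimes> x" by (simp add: m_assoc xx)
  then have b: "b = x \<otimes> (y \<otimes> (a \<otimes> (y \<otimes> x)))" unfolding bx by (simp add: m_assoc)
  have yxb: "y \<otimes> (x \<otimes> b) = a \<otimes> (y \<otimes> x)" by (subst b) simp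
  have "x \<otimes> (x \<otimes> (b \<otimes> a)) = x \<otimes> (b \<otimes> (a \<otimes> y))" using rels(3) by simp
  then have ba: "b \<otimes> a = x \<otimes> b \<otimes> (a \<otimes> y)" by (simp add: m_assoc)
  have "y \<otimes> (b \<otimes> a) = (y \<otimes> (x \<otimes> b)) \<otimes> (a \<otimes> y)" unfolding ba by (simp add: m_assoc)
  also have "\<dots> = a \<otimes> (y \<otimes> (x \<otimes> (a \<otimes> y)))" unfolding yxb by (simp add: m_assoc)
  finally have 1: "y \<otimes> (b \<otimes> a) = a \<otimes> (y \<otimes> (x \<otimes> (a \<otimes> y)))" .
  have "x \<otimes> (y \<otimes> (b \<otimes> x)) = (x \<otimes> (y \<otimes> x)) \<otimes> (y \<otimes> (a \<otimes> y))" unfolding bx by (simp add: m_assoc)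
  also have "\<dots> = y \<otimes> (x \<otimes> (a \<otimes> y))" unfolding rels(1) by (simp add: m_assoc)
  finally have 2: "x \<otimes> (y \<otimes> (b \<otimes> x)) = y \<otimes> (x \<otimes> (a \<otimes> y))" .
  \<comment> \<open>Fact \<open>2\<close> rewrites the tail after \<open>a\<close>, and what follows
    the leading \<open>x\<close> is then the right side of fact \<open>1\<close>.\<close>
  have "s 1 2 \<otimes> s 1 3 = x \<otimes> (a \<otimes> (x \<otimes> (y \<otimes> (b \<otimes> x))))" unfolding s12 s13 by (simp add: m_assoc)
  also have "\<dots> = x \<otimes> (y \<otimes> (b \<otimes> a))" unfolding 1 2 ..
  also have "\<dots> = s 1 3 \<otimes> s 1 2" unfolding s12 s13 by (simp add: m_assoc)
  finally show ?thesis .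
qed

text \<open>A permutation sending \<open>1, 2, 3\<close> to \<open>i, j, k\<close> transports the
  base case.\<close>

lemma sigma_commute_row:
  assumes "i \<in> {1..n}" "j \<in> {1..n}" "k \<in> {1..n}" "distinct [i, j, k]"
  shows "s i j \<otimes> s i k = s i k \<otimes> s i j"
proof -
  have n: "3 \<le> n" using card_mono[of "{1..n}" "{i, j, k}"] assms by simp
  obtain p where p: "p permutes {1..n}" "map p [1, 2, 3] = [i, j, k]"
    using permutes_extending_list[of "[1, 2, 3]" "[i, j, k]" "{1..n}"] assms n by auto
  obtain h where h: "h \<in> H" "\<And>i j. i \<in> {1..n} \<Longrightarrow> j \<in> {1..n} \<Longrightarrow> i \<noteq> j \<Longrightarrow> h \<otimes> s i j = s (p i) (p j) \<otimes> h"
    using p(1) by (rule permutation_action) blast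
  have p_eqs: "p 1 = i" "p 2 = j" "p 3 = k"
    using p(2) by simp_all
  have "h \<otimes> s 1 2 = s i j \<otimes> h" "h \<otimes> s 1 3 = s i k \<otimes> h"
    using h(2)[of 1 2] h(2)[of 1 3] n unfolding p_eqs by simp_all
  then show ?thesis
    by (rule commute_transfer[OF sigma_commute_base[OF n]])
      (use H_carrier[OF h(1)] n assms in \<open>simp_all add: sigma_word_words\<close>)
qed

text \<open>The letters of \<open>s 1 2\<close> carry index 1 and those of \<open>s 3 4\<close>
  index 3, so they commute; a permutation transports this to any four distinct indices.\<close>

lemma sigma_commute_disjoint:
  assumes "i \<in> {1..n}" "j \<in> {1..n}" "k \<in> {1..n}" "l \<in> {1..n}" "distinct [i, j, k, l]"
  shows "s i j \<otimes> s k l = s k l \<otimes> s i j"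
proof -
  have n: "4 \<le> n" using card_mono[of "{1..n}" "{i, j, k, l}"] assms by simp
  have g: "(1::nat) \<in> {1..<n}" "(3::nat) \<in> {1..<n}" using n by auto
  have far: "S 1 \<otimes> S 3 = S 3 \<otimes> S 1" "T 1 \<otimes> T 3 = T 3 \<otimes> T 1" "S 1 \<otimes> T 3 = T 3 \<otimes> S 1" "T 1 \<otimes> S 3 = S 3 \<otimes> T 1"
    using far_commute[OF g] far_commute(3)[OF g(2,1)] by simp_all
  have c: "S 1 \<in> carrier G" "S 3 \<in> carrier G" "T 1 \<in> carrier G" "T 3 \<in> carrier G" using g by simp_all
  have "(T 1 \<otimes> S 1) \<otimes> (T 3 \<otimes> S 3) = T 1 \<otimes> (S 1 \<otimes> T 3) \<otimes> S 3" using c by (simp add: m_assoc)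
  also have "\<dots> = (T 1 \<otimes> T 3) \<otimes> (S 1 \<otimes> S 3)" unfolding far(3) using c by (simp add: m_assoc)
  also have "\<dots> = T 3 \<otimes> (T 1 \<otimes> S 3) \<otimes> S 1" unfolding far(1,2) using c by (simp add: m_assoc)
  also have "\<dots> = (T 3 \<otimes> S 3) \<otimes> (T 1 \<otimes> S 1)" unfolding far(4) using c by (simp add: m_assoc)
  finally have base: "s 1 2 \<otimes> s 3 4 = s 3 4 \<otimes> s 1 2"
    using sigma_base(1)[OF g(1)] sigma_base(1)[OF g(2)] by (simp add: eval_nat_numeral)
  obtain p where p: "p permutes {1..n}" "map p [1, 2, 3, 4] = [i, j, k, l]"
    using permutes_extending_list[of "[1, 2, 3, 4]" "[i, j, k, l]" "{1..n}"] assms n by auto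
  obtain h where h: "h \<in> H" "\<And>i j. i \<in> {1..n} \<Longrightarrow> j \<in> {1..n} \<Longrightarrow> i \<noteq> j \<Longrightarrow> h \<otimes> s i j = s (p i) (p j) \<otimes> h"
    using p(1) by (rule permutation_action) blast
  have p_eqs: "p 1 = i" "p 2 = j" "p 3 = k" "p 4 = l"
    using p(2) by simp_all
  have "h \<otimes> s 1 2 = s i j \<otimes> h" "h \<otimes> s 3 4 = s k l \<otimes> h"
    using h(2)[of 1 2] h(2)[of 3 4] n unfolding p_eqs by simp_all
  then show ?thesis
    by (rule commute_transfer[OF base])
      (use H_carrier[OF h(1)] n assms in \<open>simp_all add: sigma_word_words\<close>)
qed

section \<open>The dichotomy for the rows and the final count\<close>

lemma row_dichotomy:
  assumes "finite H" "3 \<le> n"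
  shows "(\<forall>j\<in>{1..n-1}. \<forall>k\<in>{1..n-1}. s n j = s n k) \<or> 2 ^ (n - 2) * fact (n - 1) \<le> card H"
proof -
  have "(\<forall>j\<in>{1..n-1}. \<forall>k\<in>{1..n-1}. s n j = s n k) \<or>
      2 ^ (card {1..n-1} - 1) * fact (card {1..n-1}) \<le> card H"
  proof (rule totally_symmetric_dichotomy[OF subgroup_H assms(1), where s = "\<lambda>j. s n j"])
    show "s n j \<in> H" if "j \<in> {1..n-1}" for j
      using that by (intro ev_H sigma_word_words) auto
    show "s n i \<otimes> s n j = s n j \<otimes> s n i" if "i \<in> {1..n-1}" "j \<in> {1..n-1}" for i j
      using that assms(2) by (cases "i = j") (auto intro!: sigma_commute_row)
    show "\<exists>h\<in>H. \<forall>j\<in>{1..n-1}. h \<otimes> s n j = s n (p j) \<otimes> h" if p: "p permutes {1..n-1}" for p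
    proof -
      \<comment> \<open>As \<open>p\<close> fixes \<open>n\<close>, its action maps row
        \<open>n\<close> to itself; the last row is chosen because the other indices form the
        interval \<open>{1..n-1}\<close>.\<close>
      have "p permutes {1..n}" using p by (rule permutes_subset) auto
      then obtain h where h: "h \<in> H"
        "\<And>i j. i \<in> {1..n} \<Longrightarrow> j \<in> {1..n} \<Longrightarrow> i \<noteq> j \<Longrightarrow> h \<otimes> s i j = s (p i) (p j) \<otimes> h"
        by (rule permutation_action) blast
      have "p n = n" using p assms(2) by (auto simp: permutes_def)
      then have "\<forall>j\<in>{1..n-1}. h \<otimes> s n j = s n (p j) \<otimes> h" using h(2)[of n] by auto
      then show ?thesis using h(1) by blast
    qed
  qed (use assms in auto)
  then show ?thesis by (simp add: numeral_2_eq_2)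
qed

lemma row_collapse:
  assumes "3 \<le> n" "\<forall>j\<in>{1..n-1}. \<forall>k\<in>{1..n-1}. s n j = s n k"
    and "i \<in> {1..n}" "j \<in> {1..n}" "k \<in> {1..n}" "j \<noteq> i" "k \<noteq> i"
  shows "s i j = s i k"
proof (cases "j = k")
  case False
  \<comment> \<open>This carries the coincidence \<open>s n 1 = s n 2\<close> to the entries
    \<open>j\<close> and \<open>k\<close> of row \<open>i\<close>.\<close>
  obtain p where p: "p permutes {1..n}" "map p [n, 1, 2] = [i, j, k]"
    using permutes_extending_list[of "[n, 1, 2]" "[i, j, k]" "{1..n}"] assms(1,3-) False by auto
  obtain h where h: "h \<in> H" "\<And>i j. i \<in> {1..n} \<Longrightarrow> j \<in> {1..n} \<Longrightarrow> i \<noteq> j \<Longrightarrow> h \<otimes> s i j = s (p i) (p j) \<otimes> h"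
    using p(1) by (rule permutation_action) blast
  have "s n 1 = s n 2" using assms(1,2) by auto
  then have "s i j \<otimes> h = s i k \<otimes> h" using h(2)[of n 1] h(2)[of n 2] p(2) assms(1) by simp
  then show ?thesis using h(1) H_carrier assms(3-) by (simp add: sigma_closed)
qed simp

text \<open>Once the rows collapse, their values \<open>a i\<close> form a second symmetric family,
  now over all \<open>n\<close> indices: it is constant or gives a count beyond the claimed
  bound.\<close>

lemma cardinality_or_constant:
  assumes "finite H" "4 \<le> n"
  shows "2 ^ (n - 2) * fact (n - 1) \<le> card H
    \<or> (\<exists>c. \<forall>i\<in>{1..n}. \<forall>j\<in>{1..n}. i \<noteq> j \<longrightarrow> s i j = c)"
proof (cases "\<forall>j\<in>{1..n-1}. \<forall>k\<in>{1..n-1}. s n j = s n k")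
  case False
  then show ?thesis using row_dichotomy assms by auto
next
  case True
  \<comment> \<open>An arbitrary index other than \<open>i\<close>, picking a representative of row
    \<open>i\<close>.\<close>
  define o' :: "nat \<Rightarrow> nat" where "o' i = (if i = 1 then 2 else 1)" for i
  have o': "o' i \<in> {1..n}" "o' i \<noteq> i" for i using assms(2) by (auto simp: o'_def)
  define a where "a i = s i (o' i)" for i
  have a: "s i j = a i" if "i \<in> {1..n}" "j \<in> {1..n}" "i \<noteq> j" for i j
    unfolding a_def by (rule row_collapse[OF _ True]) (use that o' assms(2) in simp_all)
  have "(\<forall>i\<in>{1..n}. \<forall>j\<in>{1..n}. a i = a j) \<or> 2 ^ (card {1..n} - 1) * fact (card {1..n}) \<le> card H"
  proof (rule totally_symmetric_dichotomy[OF subgroup_H assms(1)])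
    show "a j \<in> H" if "j \<in> {1..n}" for j
      unfolding a_def using that o'[of j] by (intro ev_H sigma_word_words) auto
    show "a i \<otimes> a j = a j \<otimes> a i" if ij: "i \<in> {1..n}" "j \<in> {1..n}" for i j
    proof (cases "i = j")
      case False
      \<comment> \<open>With \<open>4 \<le> n\<close> there are two further indices \<open>k\<close>
        and \<open>l\<close>, so that \<open>a i = s i k\<close> and \<open>a j = s j l\<close> have
        disjoint index pairs.\<close>
      have "card {i, j} = 2" using False by simp
      then have "2 \<le> card ({1..n} - {i, j})" using assms(2) ij by (simp add: card_Diff_subset)
      then obtain Y where "Y \<subseteq> {1..n} - {i, j}" "card Y = 2" by (metis obtain_subset_with_card_n)
      then obtain k l where "k \<in> {1..n}" "l \<in> {1..n}" "distinct [i, k, j, l]"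
        using False by (auto simp: card_2_iff)
      then show ?thesis using sigma_commute_disjoint[of i k j l] a[of i k] a[of j l] ij by auto
    qed simp
    show "\<exists>h\<in>H. \<forall>j\<in>{1..n}. h \<otimes> a j = a (p j) \<otimes> h" if p: "p permutes {1..n}" for p
    proof -
      obtain h where h: "h \<in> H"
        "\<And>i j. i \<in> {1..n} \<Longrightarrow> j \<in> {1..n} \<Longrightarrow> i \<noteq> j \<Longrightarrow> h \<otimes> s i j = s (p i) (p j) \<otimes> h"
        using p by (rule permutation_action) blast
      have "h \<otimes> a j = a (p j) \<otimes> h" if j: "j \<in> {1..n}" for j
      proof -
        have "p j \<in> {1..n}" "p (o' j) \<in> {1..n}" using permutes_in_image[OF p] j o'[of j] by blast+
        moreover have "p j \<noteq> p (o' j)" using permutes_inj[OF p] o'(2)[of j] by (metis injD)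
        ultimately have "s (p j) (p (o' j)) = a (p j)" using a by simp
        then show ?thesis using h(2)[of j "o' j"] j o'[of j] by (simp add: a_def)
      qed
      then show ?thesis using h(1) by blast
    qed
  qed (use assms in auto)
  then show ?thesis
  proof
    assume const: "\<forall>i\<in>{1..n}. \<forall>j\<in>{1..n}. a i = a j"
    have "s i j = a n" if "i \<in> {1..n}" "j \<in> {1..n}" "i \<noteq> j" for i j
    proof -
      have "n \<in> {1..n}" using assms(2) by simp
      then show ?thesis using a[OF that] const that(1) by metis
    qed
    then show ?thesis by blast
  next
    assume "2 ^ (card {1..n} - 1) * fact (card {1..n}) \<le> card H"
    \<comment> \<open>The count for a family of \<open>n\<close> elements dominates that for
      \<open>n - 1\<close>.\<close>
    moreover have "(2::nat) ^ (n - 2) * fact (n - 1) \<le> 2 ^ (n - 1) * fact n"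
      by (intro mult_le_mono power_increasing fact_mono_nat) auto
    ultimately show ?thesis by simp
  qed
qed

lemma cyclic_on_PwB:
  assumes "2 \<le> n" "\<forall>i\<in>{1..n}. \<forall>j\<in>{1..n}. i \<noteq> j \<longrightarrow> s i j = c"
  shows "cyclic_hom (PwB n) G \<phi>"
  unfolding PwB_def
proof (rule cyclic_hom_subgroup_generated[OF group_wB is_group hom])
  let ?Y = "{wB_sigma n i j | i j. i \<in> {1..n} \<and> j \<in> {1..n} \<and> i \<noteq> j}"
  show "?Y \<subseteq> carrier (wB n)" using wB_sigma_in_carrier by blast
  have eq: "\<phi> (wB_sigma n i j) = s i j" for i j by (simp add: ev_def wB_sigma_def)
  \<comment> \<open>A member of the generating set is exhibited so that its image is
    \<open>{c}\<close> and not empty.\<close>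
  have "wB_sigma n 1 2 \<in> ?Y" using assms(1) by force
  moreover have "\<phi> x = c" if "x \<in> ?Y" for x using that assms(2) eq by auto
  ultimately show "\<phi> ` ?Y = {c}" by blast
qed

end

theorem theorem2:
  fixes n :: nat
    and G :: "('g, 'm) monoid_scheme"
    and \<phi> :: "braid_gen group_word set \<Rightarrow> 'g"
  assumes "n > 5"
    and "group G"
    and "finite (carrier G)"
    and "\<phi> \<in> hom (wB n) G"
  shows "abelian_hom (wB n) G \<phi>
    \<or> cyclic_hom (PwB n) G \<phi>
    \<or> card (\<phi> ` carrier (wB n)) \<ge> 2 ^ (n - 2) * fact (n - 1)
    \<or> ((\<exists>a :: nat \<Rightarrow> 'g.
          (\<forall>i\<in>{1..n}. \<phi> ` A_set n i = {a i})
          \<and> (\<forall>i\<in>{1..n}. \<forall>j\<in>{1..n}. i \<noteq> j \<longrightarrow> a i [^]\<^bsub>G\<^esub> (2::nat) \<noteq> a j [^]\<^bsub>G\<^esub> (2::nat)))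
        \<and> card (\<phi> ` carrier (wB n))
            \<ge> (nat \<lfloor>real n / 2\<rfloor> + 1) * 3 ^ (nat \<lfloor>real n / 2\<rfloor> - 1) * fact (nat \<lceil>real n / 2\<rceil>))"
proof -
  interpret wB_representation G n \<phi>
    using assms(2,4) by (simp add: wB_representation_def wB_representation_axioms_def)
  have "finite (\<phi> ` carrier (wB n))"
    using assms(3) H_carrier by (meson finite_subset subsetI)
  moreover have "4 \<le> n" "2 \<le> n" using assms(1) by simp_all
  \<comment> \<open>The count is the third alternative; a common value of all \<open>s i j\<close>
    gives the second.\<close>
  ultimately show ?thesis
    using cardinality_or_constant cyclic_on_PwB by blast
qed

end
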